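(* Let $A$ be a $*$-algebra over $K$ and let $\mu\in K\setminus\{0\}$. A map $\gamma\colon \mathrm{Cay}(A,\mu)\to\mathrm{Cay}(A,\mu)$ is an $A$-involution of $\mathrm{Cay}(A,\mu)$ if and only if it is of the form $$\gamma(x,y)=(x^*+ay^*,\,by)\qquad (x,y\in A),$$ for some $a,b\in A$ satisfying all of the following: 1. $a\in N(A)$ and $a$ is a skew $*$-element; 2. $b\in N_l(A)$ and $b^2=1$; 3. $a=ba$; 4. $\mu xy=a^2(xy)+\mu(xb^* )(by)$ for all $x,y\in A$. Moreover, the norm and trace induced by $\gamma$ are given by $$(x,y)\gamma(x,y)=\left(xx^*+xay^*+\mu(by)^*y,\ (b+1)yx-y^2a\right),$$ $$(x,y)+\gamma(x,y)=\left(x+x^*+ay^*,\ (b+1)y\right),$$ for all $x,y\in A$.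
   Context: All rings and algebras are unital. $K$ is a commutative associative ring; an algebra $A$ over $K$ is not assumed commutative or associative. An involution of $A$ is a $K$-linear map $x\mapsto x^*$ with $(x^* )^*=x$ and $(xy)^*=y^*x^*$ for all $x,y\in A$; a $*$-algebra is an algebra equipped with an involution. For a $*$-algebra $A$ and $\mu\in K\setminus\{0\}$, the Cayley double $\mathrm{Cay}(A,\mu)$ is the $K$-algebra with underlying module $A\oplus A$ and multiplication $(u,v)(x,y)=(ux+\mu y^*v,\ vx^*+yu)$. An $A$-involution of $\mathrm{Cay}(A,\mu)$ is an involution $\gamma$ of $\mathrm{Cay}(A,\mu)$ such that $\gamma(x,0)=(x^*,0)$ for all $x\in A$. The associator is $(x,y,z)=(xy)z-x(yz)$. The left nucleus is $N_l(A)=\{x\in A\mid (x,y,z)=0\ \forall y,z\in A\}$, the middle nucleus is $N_m(A)=\{y\in A\mid (x,y,z)=0\ \forall x,z\in A\}$, the right nucleus is $N_r(A)=\{z\in A\mid (x,y,z)=0\ \forall x,y\in A\}$, and the nucleus is $N(A)=N_l(A)\cap N_m(A)\cap N_r(A)$. An element $a\in A$ is skew if $a^*=-a$; it is a $*$-element if $ax=x^*a$ for all $x\in A$; a skew $*$-element is an element that is both. In an algebra with involution $\gamma$, the norm and trace of an element $z$ are $z\gamma(z)$ and $z+\gamma(z)$, respectively. *)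

theory Defs
  imports "HOL-Analysis.Product_Vector"
begin

text \<open>
  Neither associativity nor commutativity of the product is assumed, so the classes of
  \<open>HOL.Rings\<close> do not apply and the product and its unit are explicit parameters. The ground ring
  is any type of class \<open>comm_ring_1\<close>; its axiom \<open>0 \<noteq> 1\<close> loses nothing where a nonzero scalar is
  given. The unit of the algebra may equal 0.
\<close>

locale nonassoc_algebra = module smul
  for smul :: "'k::comm_ring_1 \<Rightarrow> 'a::ab_group_add \<Rightarrow> 'a" (infixr \<open>*s\<close> 75) +
  fixes mult :: "'a \<Rightarrow> 'a \<Rightarrow> 'a" (infixl \<open>\<cdot>\<close> 70)
    and one :: "'a" (\<open>\<one>\<close>)
  assumes mult_add_left: "(x + y) \<cdot> z = x \<cdot> z + y \<cdot> z"
    and mult_add_right: "x \<cdot> (y + z) = x \<cdot> y + x \<cdot> z"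
    and mult_scale_left: "(r *s x) \<cdot> y = r *s (x \<cdot> y)"
    and mult_scale_right: "x \<cdot> (r *s y) = r *s (x \<cdot> y)"
    and mult_one_left: "\<one> \<cdot> x = x"
    and mult_one_right: "x \<cdot> \<one> = x"

definition involution ::
    "('k::comm_ring_1 \<Rightarrow> 'a::ab_group_add \<Rightarrow> 'a) \<Rightarrow> ('a \<Rightarrow> 'a \<Rightarrow> 'a) \<Rightarrow> ('a \<Rightarrow> 'a) \<Rightarrow> bool" where
  "involution smul mult f \<longleftrightarrow>
     module_hom smul smul f \<and> (\<forall>x. f (f x) = x) \<and> (\<forall>x y. f (mult x y) = mult (f y) (f x))"

locale star_algebra = nonassoc_algebra smul mult one
  for smul :: "'k::comm_ring_1 \<Rightarrow> 'a::ab_group_add \<Rightarrow> 'a" (infixr \<open>*s\<close> 75)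
    and mult :: "'a \<Rightarrow> 'a \<Rightarrow> 'a" (infixl \<open>\<cdot>\<close> 70)
    and one :: "'a" (\<open>\<one>\<close>) +
  fixes star :: "'a \<Rightarrow> 'a" (\<open>_\<^sup>\<star>\<close> [1000] 999)
  assumes involution_star: "involution smul mult star"

definition associator :: "('a::ab_group_add \<Rightarrow> 'a \<Rightarrow> 'a) \<Rightarrow> 'a \<Rightarrow> 'a \<Rightarrow> 'a \<Rightarrow> 'a" where
  "associator mult x y z = mult (mult x y) z - mult x (mult y z)"

definition left_nucleus :: "('a::ab_group_add \<Rightarrow> 'a \<Rightarrow> 'a) \<Rightarrow> 'a set" where
  "left_nucleus mult = {x. \<forall>y z. associator mult x y z = 0}"

definition middle_nucleus :: "('a::ab_group_add \<Rightarrow> 'a \<Rightarrow> 'a) \<Rightarrow> 'a set" where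
  "middle_nucleus mult = {y. \<forall>x z. associator mult x y z = 0}"

definition right_nucleus :: "('a::ab_group_add \<Rightarrow> 'a \<Rightarrow> 'a) \<Rightarrow> 'a set" where
  "right_nucleus mult = {z. \<forall>x y. associator mult x y z = 0}"

definition nucleus :: "('a::ab_group_add \<Rightarrow> 'a \<Rightarrow> 'a) \<Rightarrow> 'a set" where
  "nucleus mult = left_nucleus mult \<inter> middle_nucleus mult \<inter> right_nucleus mult"

definition skew :: "('a::ab_group_add \<Rightarrow> 'a) \<Rightarrow> 'a \<Rightarrow> bool" where
  "skew star a \<longleftrightarrow> star a = - a"

definition star_element :: "('a \<Rightarrow> 'a \<Rightarrow> 'a) \<Rightarrow> ('a \<Rightarrow> 'a) \<Rightarrow> 'a \<Rightarrow> bool" where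
  "star_element mult star a \<longleftrightarrow> (\<forall>x. mult a x = mult (star x) a)"

definition skew_star_element ::
    "('a::ab_group_add \<Rightarrow> 'a \<Rightarrow> 'a) \<Rightarrow> ('a \<Rightarrow> 'a) \<Rightarrow> 'a \<Rightarrow> bool" where
  "skew_star_element mult star a \<longleftrightarrow> skew star a \<and> star_element mult star a"

definition involution_norm :: "('a \<Rightarrow> 'a \<Rightarrow> 'a) \<Rightarrow> ('a \<Rightarrow> 'a) \<Rightarrow> 'a \<Rightarrow> 'a" where
  "involution_norm mult f z = mult z (f z)"

definition involution_trace :: "('a::plus \<Rightarrow> 'a) \<Rightarrow> 'a \<Rightarrow> 'a" where
  "involution_trace f z = z + f z"

text \<open>
  The Cayley double lives on the type \<open>'a \<times> 'a\<close> with componentwise addition and scalar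
  multiplication; its unit is \<open>(\<one>, 0)\<close>.
\<close>

abbreviation cay_scale ::
    "('k::comm_ring_1 \<Rightarrow> 'a::ab_group_add \<Rightarrow> 'a) \<Rightarrow> 'k \<Rightarrow> 'a \<times> 'a \<Rightarrow> 'a \<times> 'a" where
  "cay_scale smul \<equiv> module_prod.scale smul smul"

fun cay_mult ::
    "('k::comm_ring_1 \<Rightarrow> 'a::ab_group_add \<Rightarrow> 'a) \<Rightarrow> ('a \<Rightarrow> 'a \<Rightarrow> 'a) \<Rightarrow> ('a \<Rightarrow> 'a) \<Rightarrow> 'k
      \<Rightarrow> 'a \<times> 'a \<Rightarrow> 'a \<times> 'a \<Rightarrow> 'a \<times> 'a" where
  "cay_mult smul mult star \<mu> (u, v) (x, y) =
     (mult u x + smul \<mu> (mult (star y) v), mult v (star x) + mult y u)"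

definition A_involution ::
    "('k::comm_ring_1 \<Rightarrow> 'a::ab_group_add \<Rightarrow> 'a) \<Rightarrow> ('a \<Rightarrow> 'a \<Rightarrow> 'a) \<Rightarrow> ('a \<Rightarrow> 'a) \<Rightarrow> 'k
      \<Rightarrow> ('a \<times> 'a \<Rightarrow> 'a \<times> 'a) \<Rightarrow> bool" where
  "A_involution smul mult star \<mu> \<gamma> \<longleftrightarrow>
     involution (cay_scale smul) (cay_mult smul mult star \<mu>) \<gamma> \<and>
     (\<forall>x. \<gamma> (x, 0) = (star x, 0))"

context star_algebra
begin

lemma star_simps:
  "(x + y)\<^sup>\<star> = x\<^sup>\<star> + y\<^sup>\<star>" "(r *s x)\<^sup>\<star> = r *s x\<^sup>\<star>" "(x\<^sup>\<star>)\<^sup>\<star> = x" "(x \<cdot> y)\<^sup>\<star> = y\<^sup>\<star> \<cdot> x\<^sup>\<star>"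
  using involution_star unfolding involution_def module_hom_iff by auto

lemma star_zero: "0\<^sup>\<star> = 0"
  using star_simps(1)[of 0 0] by simp

lemma star_one: "\<one>\<^sup>\<star> = \<one>"
  by (metis mult_one_left mult_one_right star_simps(3,4))

lemma mult_zero_left: "0 \<cdot> x = 0" and mult_zero_right: "x \<cdot> 0 = 0"
  using mult_add_left[of 0 0 x] mult_add_right[of x 0 0] by simp_all

lemma cay_nonassoc_algebra:
  "nonassoc_algebra (cay_scale smul) (cay_mult smul mult star \<mu>) (\<one>, 0)"
proof -
  interpret P: module_prod smul smul
    by unfold_locales
  show ?thesis
    by unfold_locales
      (auto simp: P.scale_prod scale_right_distrib mult_add_left mult_add_right
         mult_scale_left mult_scale_right mult_one_left mult_one_right mult_zero_left
         mult_zero_right star_simps star_zero star_one mult.commute)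
qed

end

end

theory Submission
  imports Defs
begin

text \<open>
  The double is generated over \<open>A\<close> by \<open>j = (0, \<one>)\<close>, since \<open>(x, y) = (x, 0) + (y, 0) j\<close>, and \<open>j\<close> obeys
  \<open>(y, 0) j = j (y\<^sup>\<star>, 0)\<close>. An involution \<open>\<gamma>\<close> extending the one of \<open>A\<close> is therefore
  determined by \<open>\<gamma> j = (a, b)\<close>, and applying \<open>\<gamma>\<close> to the two expressions for \<open>(0, y)\<close>
  gives \<open>\<gamma> (0, y) = (a \<cdot> y\<^sup>\<star>, b \<cdot> y) = (y \<cdot> a, b \<cdot> y)\<close>. So \<open>\<gamma>\<close> has the asserted form
  and \<open>a\<close> is a \<open>*\<close>-element.

  A map of this form is additive, homogeneous and extends the star, so it is an involution exactly
  when it squares to the identity and reverses the three kinds of products \<open>(x, 0) (0, y)\<close>,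
  \<open>(0, y) (x, 0)\<close> and \<open>(0, v) (0, y)\<close>. Comparing components turns this into identities in \<open>A\<close>. The second
  components of the first two products say that \<open>b\<close> associates on the left; squaring to the
  identity gives \<open>b \<cdot> b = \<one>\<close>; then \<open>\<gamma> (j j) = (\<gamma> j) (\<gamma> j)\<close> makes \<open>a\<close> skew, and
  \<open>\<gamma> (\<gamma> j) = j\<close> makes it fixed by \<open>b\<close>.

  What is left says two things. First, \<open>(y \<cdot> x) \<cdot> a\<close>, \<open>x \<cdot> (y \<cdot> a)\<close> and
  \<open>y \<cdot> (x \<cdot> a)\<close> always agree; for a skew \<open>*\<close>-element this is the same as lying in the nucleus
  (\<open>skew_star_element_in_nucleusI\<close> and \<open>nuclear_star_element_commute\<close>), because the star and the
  \<open>*\<close>-element law transport right associativity to the other two positions. Second, the first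
  component of \<open>\<gamma> ((0, v) (0, y))\<close> gives the identity involving \<open>\<mu>\<close>, once the product
  \<open>(a \<cdot> y\<^sup>\<star>) \<cdot> (a \<cdot> v\<^sup>\<star>)\<close> is rewritten as \<open>(a \<cdot> a) \<cdot> (v\<^sup>\<star> \<cdot> y)\<close>. Each
  of these steps can be reversed, which proves the converse.
\<close>

section \<open>Skew *-elements and the nucleus\<close>

context star_algebra
begin

lemma mult_minus_left: "(- x) \<cdot> y = - (x \<cdot> y)"
  by (metis add.right_inverse add_eq_0_iff mult_add_left mult_zero_left)

lemma mult_minus_right: "x \<cdot> (- y) = - (x \<cdot> y)"
  by (metis add.right_inverse add_eq_0_iff mult_add_right mult_zero_right)

lemma mult_diff_right: "x \<cdot> (y - z) = x \<cdot> y - x \<cdot> z"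
  by (simp only: diff_conv_add_uminus mult_add_right mult_minus_right)

lemma left_nucleus_iff: "b \<in> left_nucleus mult \<longleftrightarrow> (\<forall>x y. (b \<cdot> x) \<cdot> y = b \<cdot> (x \<cdot> y))"
  by (simp add: left_nucleus_def associator_def)

lemma nucleus_iff:
  "a \<in> nucleus mult \<longleftrightarrow>
     (\<forall>x y. (a \<cdot> x) \<cdot> y = a \<cdot> (x \<cdot> y) \<and> (x \<cdot> a) \<cdot> y = x \<cdot> (a \<cdot> y) \<and>
            (x \<cdot> y) \<cdot> a = x \<cdot> (y \<cdot> a))"
  by (auto simp: nucleus_def left_nucleus_def middle_nucleus_def right_nucleus_def associator_def)

lemma skew_star_element_iff:
  "skew_star_element mult star a \<longleftrightarrow> a\<^sup>\<star> = - a \<and> (\<forall>x. a \<cdot> x = x\<^sup>\<star> \<cdot> a)"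
  by (auto simp: skew_star_element_def skew_def star_element_def)

text \<open>
  A nuclear \<open>*\<close>-element turns every product into a commuting one: moving \<open>a\<close> across a factor
  stars it, so carrying \<open>a\<close> across \<open>x \<cdot> y\<close> at once and back across the two factors separately
  reverses their order and cancels the stars.
\<close>

lemma nuclear_star_element_commute:
  assumes "a \<in> nucleus mult" and "star_element mult star a"
  shows "a \<cdot> (x \<cdot> y) = a \<cdot> (y \<cdot> x)" and "(x \<cdot> y) \<cdot> a = (y \<cdot> x) \<cdot> a"
proof -
  have s: "a \<cdot> z = z\<^sup>\<star> \<cdot> a" for z
    using assms(2) by (simp add: star_element_def)
  show l: "a \<cdot> (x \<cdot> y) = a \<cdot> (y \<cdot> x)" for x y
  proof -
    have "a \<cdot> (x \<cdot> y) = (y\<^sup>\<star> \<cdot> x\<^sup>\<star>) \<cdot> a"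
      by (simp add: s star_simps)
    also have "\<dots> = y\<^sup>\<star> \<cdot> (a \<cdot> x)"
      using assms(1) s[of x] by (simp add: nucleus_iff)
    also have "\<dots> = (a \<cdot> y) \<cdot> x"
      using assms(1) s[of y] by (simp add: nucleus_iff)
    finally show ?thesis
      using assms(1) by (simp add: nucleus_iff)
  qed
  show "(x \<cdot> y) \<cdot> a = (y \<cdot> x) \<cdot> a"
    using l[of "y\<^sup>\<star>" "x\<^sup>\<star>"] by (simp add: s star_simps)
qed

text \<open>
  Right association suffices for membership in the nucleus: starring it gives left association
  because \<open>a\<close> is skew, and the \<open>*\<close>-element law carries \<open>a\<close> from the middle to the outside, where
  the assumed commutation undoes the reversal that this causes.
\<close>

lemma skew_star_element_in_nucleusI:
  assumes "skew_star_element mult star a"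
    and assoc: "\<And>x y. (x \<cdot> y) \<cdot> a = x \<cdot> (y \<cdot> a)"
    and comm: "\<And>x y. (x \<cdot> y) \<cdot> a = (y \<cdot> x) \<cdot> a"
  shows "a \<in> nucleus mult"
proof -
  have skew: "a\<^sup>\<star> = - a" and s: "\<And>x. a \<cdot> x = x\<^sup>\<star> \<cdot> a"
    using assms(1) by (auto simp: skew_star_element_iff)
  have left: "(a \<cdot> x) \<cdot> y = a \<cdot> (x \<cdot> y)" for x y
    using arg_cong[OF assoc[of "y\<^sup>\<star>" "x\<^sup>\<star>"], of star]
    by (simp add: star_simps skew mult_minus_left)
  have middle: "(x \<cdot> a) \<cdot> y = x \<cdot> (a \<cdot> y)" for x y
  proof -
    have "(x \<cdot> a) \<cdot> y = (a \<cdot> x\<^sup>\<star>) \<cdot> y"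
      using s[of "x\<^sup>\<star>"] by (simp add: star_simps)
    also have "\<dots> = a \<cdot> (x\<^sup>\<star> \<cdot> y)"
      by (rule left)
    also have "\<dots> = (y\<^sup>\<star> \<cdot> x) \<cdot> a"
      by (simp only: s star_simps)
    also have "\<dots> = x \<cdot> (y\<^sup>\<star> \<cdot> a)"
      using comm[of "y\<^sup>\<star>" x] by (simp only: assoc)
    also have "\<dots> = x \<cdot> (a \<cdot> y)"
      by (simp only: s[of y])
    finally show ?thesis .
  qed
  show ?thesis
    using assoc left middle by (simp add: nucleus_iff)
qed

text \<open>
  This product arises as the part of \<open>\<gamma> (0, y) \<gamma> (0, v)\<close> that does not involve \<open>\<mu>\<close>, for
  \<open>\<gamma> (0, y) = (a \<cdot> y\<^sup>\<star>, b \<cdot> y)\<close>.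
\<close>

lemma nuclear_star_element_square:
  assumes "a \<in> nucleus mult" and "star_element mult star a"
  shows "(a \<cdot> y\<^sup>\<star>) \<cdot> (a \<cdot> x) = (a \<cdot> a) \<cdot> (x \<cdot> y)"
proof -
  have N: "(a \<cdot> z) \<cdot> w = a \<cdot> (z \<cdot> w)" "(z \<cdot> a) \<cdot> w = z \<cdot> (a \<cdot> w)" for z w
    using assms(1) by (auto simp: nucleus_iff)
  have s: "y\<^sup>\<star> \<cdot> a = a \<cdot> y"
    using assms(2) by (simp add: star_element_def)
  have "(a \<cdot> y\<^sup>\<star>) \<cdot> (a \<cdot> x) = a \<cdot> ((y\<^sup>\<star> \<cdot> a) \<cdot> x)"
    by (simp add: N)
  also have "\<dots> = a \<cdot> (a \<cdot> (y \<cdot> x))"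
    by (simp only: s N)
  also have "\<dots> = (a \<cdot> a) \<cdot> (x \<cdot> y)"
    using nuclear_star_element_commute(1)[OF assms, of y x] by (simp only: N)
  finally show ?thesis .
qed

section \<open>Involutions of the double extending the given one\<close>

text \<open>
  Here \<open>(a, b)\<close> stands for the image of \<open>(0, \<one>)\<close> under an involution of the double that extends the
  star; this image determines the involution.
\<close>

definition cay_involution_pair :: "'k \<Rightarrow> 'a \<Rightarrow> 'a \<Rightarrow> bool" where
  "cay_involution_pair \<mu> a b \<longleftrightarrow>
     (a \<in> nucleus mult \<and> skew_star_element mult star a) \<and>
     (b \<in> left_nucleus mult \<and> b \<cdot> b = \<one>) \<and>
     a = b \<cdot> a \<and>
     (\<forall>x y. \<mu> *s (x \<cdot> y) = (a \<cdot> a) \<cdot> (x \<cdot> y) + \<mu> *s ((x \<cdot> b\<^sup>\<star>) \<cdot> (b \<cdot> y)))"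

lemma cay_involution_pairD:
  assumes "cay_involution_pair \<mu> a b"
  shows "a \<in> nucleus mult" and "skew_star_element mult star a" and "b \<in> left_nucleus mult"
    and "b \<cdot> b = \<one>" and "b \<cdot> a = a"
    and "\<mu> *s (x \<cdot> y) = (a \<cdot> a) \<cdot> (x \<cdot> y) + \<mu> *s ((x \<cdot> b\<^sup>\<star>) \<cdot> (b \<cdot> y))"
  using assms unfolding cay_involution_pair_def
  by - (elim conjE, (assumption | erule sym | (drule spec)+, assumption))+

lemma A_involution_iff:
  "A_involution smul mult star \<mu> \<gamma> \<longleftrightarrow>
     (\<forall>z w. \<gamma> (z + w) = \<gamma> z + \<gamma> w) \<and>
     (\<forall>r x y. \<gamma> (r *s x, r *s y) = (r *s fst (\<gamma> (x, y)), r *s snd (\<gamma> (x, y)))) \<and>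
     (\<forall>z. \<gamma> (\<gamma> z) = z) \<and>
     (\<forall>z w. \<gamma> (cay_mult smul mult star \<mu> z w) = cay_mult smul mult star \<mu> (\<gamma> w) (\<gamma> z)) \<and>
     (\<forall>x. \<gamma> (x, 0) = (x\<^sup>\<star>, 0))"
proof -
  interpret P: module_prod smul smul
    by unfold_locales
  have "module (cay_scale smul)"
    using cay_nonassoc_algebra by (rule nonassoc_algebra.axioms(1))
  then show ?thesis
    by (auto simp: A_involution_def involution_def module_hom_iff P.scale_def split_def)
qed

lemma A_involution_determined:
  assumes \<gamma>: "A_involution smul mult star \<mu> \<gamma>" and ab: "\<gamma> (0, \<one>) = (a, b)"
  shows "\<gamma> (x, y) = (x\<^sup>\<star> + a \<cdot> y\<^sup>\<star>, b \<cdot> y)" and "a \<cdot> x = x\<^sup>\<star> \<cdot> a"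
proof -
  have base: "\<gamma> (x, 0) = (x\<^sup>\<star>, 0)"
    and anti: "\<gamma> (cay_mult smul mult star \<mu> z w) = cay_mult smul mult star \<mu> (\<gamma> w) (\<gamma> z)"
    for x z w
    using \<gamma> unfolding A_involution_iff by blast+
  have r: "\<gamma> (0, y) = (a \<cdot> y\<^sup>\<star>, b \<cdot> y)" for y
    using anti[of "(y, 0)" "(0, \<one>)"]
    by (simp add: base ab star_simps star_zero mult_zero_left mult_zero_right mult_one_left
        mult_one_right scale_zero_right)
  have l: "\<gamma> (0, y) = (y \<cdot> a, b \<cdot> y)" for y
    using anti[of "(0, \<one>)" "(y\<^sup>\<star>, 0)"]
    by (simp add: base ab star_simps star_zero mult_zero_left mult_zero_right mult_one_left
        mult_one_right scale_zero_right)
  show "\<gamma> (x, y) = (x\<^sup>\<star> + a \<cdot> y\<^sup>\<star>, b \<cdot> y)"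
  proof -
    have "\<gamma> ((x, 0) + (0, y)) = \<gamma> (x, 0) + \<gamma> (0, y)"
      using \<gamma> unfolding A_involution_iff by blast
    then show ?thesis
      by (simp add: base r)
  qed
  show "a \<cdot> x = x\<^sup>\<star> \<cdot> a"
    using r[of "x\<^sup>\<star>"] l[of "x\<^sup>\<star>"] by (simp add: star_simps)
qed

text \<open>
  The hypotheses are what the components of \<open>\<gamma> (\<gamma> z) = z\<close> and of the reversal of products say
  about \<open>a\<close> and \<open>b\<close>. Skewness comes from \<open>cross\<close> at \<open>\<one>\<close>. After that, starring \<open>rev_a\<close> gives
  \<open>(y \<cdot> x) \<cdot> a = x \<cdot> (y \<cdot> a)\<close>, and cancelling \<open>b\<close> in \<open>cross\<close> allows \<open>x\<close> and \<open>y\<close> to be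
  exchanged on the right; together these are right association and commutation next to \<open>a\<close>, which
  put \<open>a\<close> into the nucleus.
\<close>

lemma cay_involution_pair_from_identities:
  assumes s: "\<And>x. a \<cdot> x = x\<^sup>\<star> \<cdot> a"
    and skew_b: "a\<^sup>\<star> + a \<cdot> b\<^sup>\<star> = 0"
    and invol_b: "\<And>y. b \<cdot> (b \<cdot> y) = y"
    and left_b: "\<And>x y. (b \<cdot> x) \<cdot> y = b \<cdot> (x \<cdot> y)"
    and rev_a: "\<And>x y. a \<cdot> (x \<cdot> y) = (a \<cdot> y) \<cdot> x"
    and cross: "\<And>v y. (b \<cdot> y) \<cdot> (a \<cdot> v\<^sup>\<star>)\<^sup>\<star> + (b \<cdot> v) \<cdot> (a \<cdot> y\<^sup>\<star>) = 0"
    and scaled: "\<And>v y. \<mu> *s (v\<^sup>\<star> \<cdot> y) = (a \<cdot> y\<^sup>\<star>) \<cdot> (a \<cdot> v\<^sup>\<star>) + \<mu> *s ((b \<cdot> v)\<^sup>\<star> \<cdot> (b \<cdot> y))"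
  shows "cay_involution_pair \<mu> a b"
proof -
  have "b \<cdot> (a\<^sup>\<star> + a) = 0"
    using cross[of \<one> \<one>] by (simp add: star_one mult_one_left mult_one_right mult_add_right)
  then have "a\<^sup>\<star> + a = 0"
    using invol_b[of "a\<^sup>\<star> + a"] by (simp add: mult_zero_right)
  then have skew: "a\<^sup>\<star> = - a"
    by (simp add: eq_neg_iff_add_eq_0)
  have ba: "b \<cdot> a = a"
    using skew_b s[of "b\<^sup>\<star>"] by (simp add: star_simps skew)
  have star_el: "skew_star_element mult star a"
    using skew s by (simp add: skew_star_element_iff)
  have assoc_swap: "(y \<cdot> x) \<cdot> a = x \<cdot> (y \<cdot> a)" for x y
    using arg_cong[OF rev_a[of "x\<^sup>\<star>" "y\<^sup>\<star>"], of star]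
    by (simp add: star_simps skew mult_minus_right)
  have swap: "y \<cdot> (v \<cdot> a) = v \<cdot> (y \<cdot> a)" for v y
  proof -
    have "b \<cdot> (y \<cdot> (v \<cdot> a)) = b \<cdot> (v \<cdot> (y \<cdot> a))"
      using cross[of y v] s[of "y\<^sup>\<star>"] s[of "v\<^sup>\<star>"]
      by (simp add: star_simps skew mult_minus_left mult_minus_right left_b)
    then show ?thesis
      by (metis invol_b)
  qed
  have assoc: "(x \<cdot> y) \<cdot> a = x \<cdot> (y \<cdot> a)" for x y
    by (simp only: assoc_swap swap)
  have nuc: "a \<in> nucleus mult"
    using star_el assoc by (rule skew_star_element_in_nucleusI) (simp only: assoc swap)
  have "\<mu> *s (x \<cdot> y) = (a \<cdot> a) \<cdot> (x \<cdot> y) + \<mu> *s ((x \<cdot> b\<^sup>\<star>) \<cdot> (b \<cdot> y))" for x y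
    using scaled[of "x\<^sup>\<star>" y] nuclear_star_element_square[OF nuc, of y x] s
    by (simp add: star_simps star_element_def)
  moreover have "b \<cdot> b = \<one>"
    using invol_b[of \<one>] by (simp add: mult_one_right)
  ultimately show ?thesis
    using nuc star_el ba[symmetric] left_b
    unfolding cay_involution_pair_def left_nucleus_iff by blast
qed

lemma A_involution_imp_cay_involution_pair:
  assumes \<gamma>: "A_involution smul mult star \<mu> \<gamma>" and ab: "\<gamma> (0, \<one>) = (a, b)"
  shows "cay_involution_pair \<mu> a b"
proof -
  note form = A_involution_determined(1)[OF \<gamma> ab]
  have anti: "\<gamma> (cay_mult smul mult star \<mu> z w) = cay_mult smul mult star \<mu> (\<gamma> w) (\<gamma> z)"
    and invol: "\<gamma> (\<gamma> z) = z" for z w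
    using \<gamma> unfolding A_involution_iff by blast+
  note zeros = star_zero star_one mult_zero_left mult_zero_right mult_one_right scale_zero_right
  show ?thesis
  proof (rule cay_involution_pair_from_identities)
    show "a \<cdot> x = x\<^sup>\<star> \<cdot> a" for x
      by (rule A_involution_determined(2)[OF \<gamma> ab])
    show "a\<^sup>\<star> + a \<cdot> b\<^sup>\<star> = 0"
      using invol[of "(0, \<one>)"] by (simp add: form zeros)
    show "b \<cdot> (b \<cdot> y) = y" for y
      using invol[of "(0, y)"] by (simp add: form)
    show "(b \<cdot> x) \<cdot> y = b \<cdot> (x \<cdot> y)" for x y
      using anti[of "(y, 0)" "(0, x)"] by (simp add: form zeros star_simps)
    show "a \<cdot> (x \<cdot> y) = (a \<cdot> y) \<cdot> x" for x y
      using anti[of "(x\<^sup>\<star>, 0)" "(0, y\<^sup>\<star>)"] by (simp add: form zeros star_simps)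
    show "(b \<cdot> y) \<cdot> (a \<cdot> v\<^sup>\<star>)\<^sup>\<star> + (b \<cdot> v) \<cdot> (a \<cdot> y\<^sup>\<star>) = 0"
      and "\<mu> *s (v\<^sup>\<star> \<cdot> y) = (a \<cdot> y\<^sup>\<star>) \<cdot> (a \<cdot> v\<^sup>\<star>) + \<mu> *s ((b \<cdot> v)\<^sup>\<star> \<cdot> (b \<cdot> y))" for v y
      using anti[of "(0, v)" "(0, y)"] by (simp_all add: form zeros star_simps)
  qed
qed

text \<open>
  In every term that involves \<open>a\<close>, two rules remove what obstructs the product reversal: factors
  next to \<open>a\<close> commute, and \<open>b\<close> disappears next to \<open>a\<close>, as in
  \<open>(b \<cdot> y) \<cdot> a = b \<cdot> (a \<cdot> y\<^sup>\<star>) = (b \<cdot> a) \<cdot> y\<^sup>\<star> = a \<cdot> y\<^sup>\<star> = y \<cdot> a\<close>.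
\<close>

lemma cay_involution_pair_imp_A_involution:
  assumes pair: "cay_involution_pair \<mu> a b"
    and form: "\<And>x y. \<gamma> (x, y) = (x\<^sup>\<star> + a \<cdot> y\<^sup>\<star>, b \<cdot> y)"
  shows "A_involution smul mult star \<mu> \<gamma>"
proof -
  note nuc = cay_involution_pairD(1)[OF pair] and bb = cay_involution_pairD(4)[OF pair]
    and ba = cay_involution_pairD(5)[OF pair] and scaled = cay_involution_pairD(6)[OF pair]
  have star_el: "star_element mult star a" and skew: "a\<^sup>\<star> = - a"
    and s: "\<And>x. a \<cdot> x = x\<^sup>\<star> \<cdot> a"
    using cay_involution_pairD(2)[OF pair] unfolding skew_star_element_iff star_element_def
    by blast+
  have left_b: "(b \<cdot> x) \<cdot> y = b \<cdot> (x \<cdot> y)" for x y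
    using cay_involution_pairD(3)[OF pair] by (simp add: left_nucleus_iff)
  have N: "(a \<cdot> x) \<cdot> y = a \<cdot> (x \<cdot> y)" "(x \<cdot> a) \<cdot> y = x \<cdot> (a \<cdot> y)" "(x \<cdot> y) \<cdot> a = x \<cdot> (y \<cdot> a)"
    for x y
    using nuc by (auto simp: nucleus_iff)
  note comm = nuclear_star_element_commute[OF nuc star_el]
  have s': "a \<cdot> y\<^sup>\<star> = y \<cdot> a" for y
    by (simp add: s star_simps)
  have swap: "y \<cdot> (v \<cdot> a) = v \<cdot> (y \<cdot> a)" for v y
    using comm(2)[of y v] by (simp add: N)
  have ba': "b \<cdot> (y \<cdot> a) = y \<cdot> a" for y
    using left_b[of a "y\<^sup>\<star>"] by (simp only: ba s')
  have invol_b: "b \<cdot> (b \<cdot> y) = y" for y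
    using left_b[of b y] by (simp add: bb mult_one_left)
  have anti: "\<gamma> (cay_mult smul mult star \<mu> (u, v) (x, y)) =
      cay_mult smul mult star \<mu> (\<gamma> (x, y)) (\<gamma> (u, v))" for u v x y
  proof -
    have "\<mu> *s (v\<^sup>\<star> \<cdot> y) = (a \<cdot> y\<^sup>\<star>) \<cdot> (a \<cdot> v\<^sup>\<star>) + \<mu> *s ((v\<^sup>\<star> \<cdot> b\<^sup>\<star>) \<cdot> (b \<cdot> y))"
      using scaled[of "v\<^sup>\<star>" y] nuclear_star_element_square[OF nuc star_el, of y "v\<^sup>\<star>"] by simp
    moreover have "a \<cdot> (x \<cdot> v\<^sup>\<star>) = x\<^sup>\<star> \<cdot> (a \<cdot> v\<^sup>\<star>)"
      by (metis N(1,2) s)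
    moreover have "a \<cdot> (u\<^sup>\<star> \<cdot> y\<^sup>\<star>) = (a \<cdot> y\<^sup>\<star>) \<cdot> u\<^sup>\<star>"
      by (simp only: N comm(1)[of "u\<^sup>\<star>"])
    ultimately have fst_eq: "(u \<cdot> x + \<mu> *s (y\<^sup>\<star> \<cdot> v))\<^sup>\<star> + a \<cdot> (v \<cdot> x\<^sup>\<star> + y \<cdot> u)\<^sup>\<star> =
        (x\<^sup>\<star> + a \<cdot> y\<^sup>\<star>) \<cdot> (u\<^sup>\<star> + a \<cdot> v\<^sup>\<star>) + \<mu> *s ((b \<cdot> v)\<^sup>\<star> \<cdot> (b \<cdot> y))"
      by (simp add: star_simps mult_add_left mult_add_right add_ac)
    have "(b \<cdot> y) \<cdot> (a \<cdot> v\<^sup>\<star>)\<^sup>\<star> + (b \<cdot> v) \<cdot> (a \<cdot> y\<^sup>\<star>) = 0"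
      by (simp add: star_simps skew mult_minus_left mult_minus_right left_b s' swap[of y v])
    then have snd_eq: "b \<cdot> (v \<cdot> x\<^sup>\<star> + y \<cdot> u) =
        (b \<cdot> y) \<cdot> (u\<^sup>\<star> + a \<cdot> v\<^sup>\<star>)\<^sup>\<star> + (b \<cdot> v) \<cdot> (x\<^sup>\<star> + a \<cdot> y\<^sup>\<star>)"
      by (simp add: star_simps(1,3) mult_add_left mult_add_right left_b add.assoc add.left_commute)
    show ?thesis
      using fst_eq snd_eq by (simp add: form)
  qed
  have invol: "\<gamma> (\<gamma> (x, y)) = (x, y)" for x y
    by (simp add: form star_simps invol_b skew mult_minus_right s'[of "b \<cdot> y", unfolded star_simps]
        left_b ba')
  show ?thesis
    unfolding A_involution_iff
    using anti invol
    by (auto simp: form star_simps star_zero mult_add_right mult_scale_right mult_zero_right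
        scale_right_distrib)
qed

text \<open>
  The only products that do not simply expand are \<open>x \<cdot> (a \<cdot> y\<^sup>\<star>)\<close> and \<open>y \<cdot> (y \<cdot> a)\<close>, reassociated
  by the nucleus, and \<open>(b \<cdot> y) \<cdot> x\<close>, where \<open>b\<close> is pulled out on the left; the minus sign is that of
  \<open>a\<^sup>\<star> = - a\<close>.
\<close>

lemma cay_involution_norm_trace:
  assumes pair: "cay_involution_pair \<mu> a b"
    and form: "\<And>x y. \<gamma> (x, y) = (x\<^sup>\<star> + a \<cdot> y\<^sup>\<star>, b \<cdot> y)"
  shows "involution_norm (cay_mult smul mult star \<mu>) \<gamma> (x, y) =
      (x \<cdot> x\<^sup>\<star> + (x \<cdot> a) \<cdot> y\<^sup>\<star> + \<mu> *s ((b \<cdot> y)\<^sup>\<star> \<cdot> y), (b + \<one>) \<cdot> (y \<cdot> x) - (y \<cdot> y) \<cdot> a)"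
    and "involution_trace \<gamma> (x, y) = (x + x\<^sup>\<star> + a \<cdot> y\<^sup>\<star>, (b + \<one>) \<cdot> y)"
proof -
  have "a\<^sup>\<star> = - a" and "(b \<cdot> y) \<cdot> x = b \<cdot> (y \<cdot> x)"
    and "(x \<cdot> a) \<cdot> y\<^sup>\<star> = x \<cdot> (a \<cdot> y\<^sup>\<star>)" and "(y \<cdot> y) \<cdot> a = y \<cdot> (y \<cdot> a)"
    using cay_involution_pairD(1-3)[OF pair]
    by (auto simp: skew_star_element_iff nucleus_iff left_nucleus_iff)
  then show "involution_norm (cay_mult smul mult star \<mu>) \<gamma> (x, y) =
      (x \<cdot> x\<^sup>\<star> + (x \<cdot> a) \<cdot> y\<^sup>\<star> + \<mu> *s ((b \<cdot> y)\<^sup>\<star> \<cdot> y), (b + \<one>) \<cdot> (y \<cdot> x) - (y \<cdot> y) \<cdot> a)"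
    by (simp add: involution_norm_def form star_simps mult_add_left mult_add_right mult_minus_right
        mult_diff_right mult_one_left)
  show "involution_trace \<gamma> (x, y) = (x + x\<^sup>\<star> + a \<cdot> y\<^sup>\<star>, (b + \<one>) \<cdot> y)"
    by (simp add: involution_trace_def form mult_add_left mult_one_left add.commute add.assoc)
qed

end

theorem theorem1:
  fixes smul :: "'k::comm_ring_1 \<Rightarrow> 'a::ab_group_add \<Rightarrow> 'a" (infixr \<open>*s\<close> 75)
    and mult :: "'a \<Rightarrow> 'a \<Rightarrow> 'a" (infixl \<open>\<cdot>\<close> 70)
    and one :: 'a (\<open>\<one>\<close>)
    and star :: "'a \<Rightarrow> 'a" (\<open>_\<^sup>\<star>\<close> [1000] 999)
    and \<mu> :: 'k
    and \<gamma> :: "'a \<times> 'a \<Rightarrow> 'a \<times> 'a"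
  assumes "star_algebra smul mult one star"
    and "\<mu> \<noteq> 0"
  shows
    "(A_involution smul mult star \<mu> \<gamma> \<longleftrightarrow>
        (\<exists>a b.
           (a \<in> nucleus mult \<and> skew_star_element mult star a) \<and>
           (b \<in> left_nucleus mult \<and> b \<cdot> b = \<one>) \<and>
           a = b \<cdot> a \<and>
           (\<forall>x y. \<mu> *s (x \<cdot> y) = (a \<cdot> a) \<cdot> (x \<cdot> y) + \<mu> *s ((x \<cdot> b\<^sup>\<star>) \<cdot> (b \<cdot> y))) \<and>
           (\<forall>x y. \<gamma> (x, y) = (x\<^sup>\<star> + a \<cdot> y\<^sup>\<star>, b \<cdot> y)))) \<and>
     (\<forall>a b.
        (a \<in> nucleus mult \<and> skew_star_element mult star a) \<and>
        (b \<in> left_nucleus mult \<and> b \<cdot> b = \<one>) \<and>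
        a = b \<cdot> a \<and>
        (\<forall>x y. \<mu> *s (x \<cdot> y) = (a \<cdot> a) \<cdot> (x \<cdot> y) + \<mu> *s ((x \<cdot> b\<^sup>\<star>) \<cdot> (b \<cdot> y))) \<and>
        (\<forall>x y. \<gamma> (x, y) = (x\<^sup>\<star> + a \<cdot> y\<^sup>\<star>, b \<cdot> y)) \<longrightarrow>
        (\<forall>x y.
           involution_norm (cay_mult smul mult star \<mu>) \<gamma> (x, y) =
             (x \<cdot> x\<^sup>\<star> + (x \<cdot> a) \<cdot> y\<^sup>\<star> + \<mu> *s ((b \<cdot> y)\<^sup>\<star> \<cdot> y),
              (b + \<one>) \<cdot> (y \<cdot> x) - (y \<cdot> y) \<cdot> a) \<and>
           involution_trace \<gamma> (x, y) =
             (x + x\<^sup>\<star> + a \<cdot> y\<^sup>\<star>, (b + \<one>) \<cdot> y)))"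
proof -
  interpret star_algebra smul mult one star
    by fact
  have "A_involution smul mult star \<mu> \<gamma> \<longleftrightarrow>
      (\<exists>a b. cay_involution_pair \<mu> a b \<and> (\<forall>x y. \<gamma> (x, y) = (x\<^sup>\<star> + a \<cdot> y\<^sup>\<star>, b \<cdot> y)))"
  proof
    assume \<gamma>: "A_involution smul mult star \<mu> \<gamma>"
    obtain a b where ab: "\<gamma> (0, \<one>) = (a, b)"
      by fastforce
    show "\<exists>a b. cay_involution_pair \<mu> a b \<and> (\<forall>x y. \<gamma> (x, y) = (x\<^sup>\<star> + a \<cdot> y\<^sup>\<star>, b \<cdot> y))"
      using A_involution_imp_cay_involution_pair[OF \<gamma> ab] A_involution_determined(1)[OF \<gamma> ab]
      by blast
  qed (auto intro: cay_involution_pair_imp_A_involution)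
  moreover have "\<forall>a b. cay_involution_pair \<mu> a b \<and> (\<forall>x y. \<gamma> (x, y) = (x\<^sup>\<star> + a \<cdot> y\<^sup>\<star>, b \<cdot> y)) \<longrightarrow>
      (\<forall>x y.
         involution_norm (cay_mult smul mult star \<mu>) \<gamma> (x, y) =
           (x \<cdot> x\<^sup>\<star> + (x \<cdot> a) \<cdot> y\<^sup>\<star> + \<mu> *s ((b \<cdot> y)\<^sup>\<star> \<cdot> y),
            (b + \<one>) \<cdot> (y \<cdot> x) - (y \<cdot> y) \<cdot> a) \<and>
         involution_trace \<gamma> (x, y) = (x + x\<^sup>\<star> + a \<cdot> y\<^sup>\<star>, (b + \<one>) \<cdot> y))"
    by (intro allI impI conjI; elim conjE; rule cay_involution_norm_trace; simp)
  ultimately show ?thesis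
    unfolding cay_involution_pair_def by (simp only: conj_assoc)
qed

end
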